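(* Let $K$ be a field of characteristic not in $\{2,3\}$, such that $3$ is not the square of an element of $K$ and $-3$ is not the fourth power of an element of $K$. Then $$f(x)=\left(x+192t^8-7t^2\right)^4-192t^8$$ has a newly reducible second iterate over $K$ for any $t\in K$, $t\neq 0$.
   Context: $f^2$ denotes the second iterate $f\circ f$. $f$ has a newly reducible second iterate over $K$ if $f$ is irreducible over $K$ but $f^2$ is not irreducible over $K$. *)

theory Defs
  imports "HOL-Computational_Algebra.Polynomial"
begin

definition newly_reducible_second_iterate :: "'a::field poly \<Rightarrow> bool" where
  "newly_reducible_second_iterate f \<longleftrightarrow> irreducible f \<and> \<not> irreducible (pcompose f f)"

end

theory Submission
  imports Defs
begin

text \<open>
  Write \<open>Y = x + c\<close> with \<open>c = 192 t\<^sup>8 - 7 t\<^sup>2\<close>, so that \<open>f = Y\<^sup>4 - 192 t\<^sup>8\<close>. The shift is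
  chosen such that \<open>f + c = Y\<^sup>4 - 7 t\<^sup>2\<close>, whence \<open>f \<circ> f = (Y\<^sup>4 - 7 t\<^sup>2)\<^sup>4 - 192 t\<^sup>8\<close>.

  Irreducibility of \<open>f\<close> is invariant under the translation, and \<open>X\<^sup>4 - b\<close> is irreducible as soon
  as \<open>b\<close> is neither a square nor of the form \<open>-4 k\<^sup>4\<close>. For \<open>b = 192 t\<^sup>8 = 3 (8 t\<^sup>4)\<^sup>2\<close> a square root
  of \<open>b\<close> gives one of \<open>3\<close>, and \<open>b = -4 k\<^sup>4\<close> means \<open>(k / (2 t\<^sup>2))\<^sup>4 = -3\<close>.

  The second iterate factors because, for a root \<open>\<beta>\<close> of \<open>X\<^sup>4 - 192 t\<^sup>8\<close>, the element \<open>7 t\<^sup>2 + \<beta>\<close>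
  is already a square in \<open>K(\<beta>)\<close>, namely that of
  \<open>(\<beta>\<^sup>2 + 8 t\<^sup>2 \<beta> - 40 t\<^sup>4) / (4 t (\<beta> - 4 t\<^sup>2))\<close>; here \<open>\<beta> \<noteq> 4 t\<^sup>2\<close> since \<open>256 t\<^sup>8 \<noteq> 192 t\<^sup>8\<close>.
  So \<open>Y\<^sup>4 - (7 t\<^sup>2 + \<beta>)\<close> is a difference of two squares over \<open>K(\<beta>)\<close>, and taking norms of its two
  factors down to \<open>K\<close> writes \<open>f \<circ> f\<close> as a product \<open>A(Y\<^sup>2) A(-Y\<^sup>2)\<close> of two polynomials of degree 8
  over \<open>K\<close>. Once \<open>A\<close> is known, only a polynomial identity remains to be checked
  (\<open>second_iterate_factorization\<close>).
\<close>

lemma is_unit_pcompose_translation_iff: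
  fixes p :: "'a::field poly"
  shows "is_unit (pcompose p [:h, 1:]) \<longleftrightarrow> is_unit p"
proof (cases "p = 0")
  case False
  then have "pcompose p [:h, 1:] \<noteq> 0" by (simp add: pcompose_eq_0_iff)
  with False show ?thesis by (simp add: is_unit_iff_degree degree_pcompose)
qed simp

lemma irreducible_pcompose_translation:
  fixes p :: "'a::field poly"
  assumes "irreducible p"
  shows "irreducible (pcompose p [:h, 1:])"
proof (rule irreducibleI)
  show "pcompose p [:h, 1:] \<noteq> 0"
    using assms by (auto simp: pcompose_eq_0_iff)
  show "\<not> is_unit (pcompose p [:h, 1:])"
    using assms by (simp add: is_unit_pcompose_translation_iff irreducible_not_unit)
next
  fix q r assume "pcompose p [:h, 1:] = q * r"
  then have "pcompose (pcompose p [:h, 1:]) [:- h, 1:] = pcompose q [:- h, 1:] * pcompose r [:- h, 1:]"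
    by (simp add: pcompose_mult)
  then have "p = pcompose q [:- h, 1:] * pcompose r [:- h, 1:]"
    by (simp add: pcompose_assoc[symmetric] pcompose_pCons)
  then have "is_unit (pcompose q [:- h, 1:]) \<or> is_unit (pcompose r [:- h, 1:])"
    using assms irreducibleD by blast
  then show "is_unit q \<or> is_unit r"
    by (simp only: is_unit_pcompose_translation_iff)
qed

lemma degree_one_poly_has_root:
  fixes p :: "'a::field poly"
  assumes "degree p = 1"
  shows "\<exists>z. poly p z = 0"
proof -
  obtain a b where "p = [:a, b:]" "b \<noteq> 0"
    using assms by (metis degree1_coeffs)
  then have "poly p (- a / b) = 0" by simp
  then show ?thesis ..
qed

text \<open>
  A linear factor gives \<open>z\<^sup>4 = b\<close>, hence a square root of \<open>b\<close>. A quadratic factorization has, for lack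
  of a cubic term, the form \<open>(X\<^sup>2 + u X + v) (X\<^sup>2 - u X + w)\<close>; the linear term forces \<open>u = 0\<close>
  or \<open>v = w\<close>. In the first case \<open>b = v\<^sup>2\<close>, in the second \<open>2 v = u\<^sup>2\<close> and \<open>b = - v\<^sup>2\<close>,
  hence \<open>b = -4 (u/2)\<^sup>4\<close>; in characteristic 2 the second case collapses to \<open>u = 0\<close>.
\<close>
lemma irreducible_fourth_power_minus_const:
  fixes b :: "'a::field"
  assumes nsq: "\<not> (\<exists>a. a ^ 2 = b)" and nq: "\<not> (\<exists>a. - 4 * a ^ 4 = b)"
  shows "irreducible [:- b, 0, 0, 0, 1:]"
proof (rule irreducibleI)
  show "[:- b, 0, 0, 0, 1:] \<noteq> 0" "\<not> is_unit [:- b, 0, 0, 0, 1:]"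
    by (simp_all add: is_unit_iff_degree)
next
  fix p q assume pq: "[:- b, 0, 0, 0, 1:] = p * q"
  have nz: "p \<noteq> 0" "q \<noteq> 0" using pq by auto
  have deg: "degree p + degree q = 4"
    using degree_mult_eq[OF nz] by (simp add: pq[symmetric])
  have noroot: "poly (p * q) z \<noteq> 0" for z
  proof
    assume "poly (p * q) z = 0"
    then have "(z ^ 2) ^ 2 = b"
      by (simp add: pq[symmetric] algebra_simps eval_nat_numeral)
    then show False using nsq by blast
  qed
  have "degree p \<noteq> 1" "degree q \<noteq> 1"
    using degree_one_poly_has_root[of p] degree_one_poly_has_root[of q] noroot by auto
  moreover have "\<not> (degree p = 2 \<and> degree q = 2)"
  proof
    assume "degree p = 2 \<and> degree q = 2"
    then obtain p0 p1 p2 q0 q1 q2 where P: "p = [:p0, p1, p2:]" and Q: "q = [:q0, q1, q2:]"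
      by (metis degree2_coeffs)
    have e: "p0 * q0 = - b" "p0 * q1 + p1 * q0 = 0" "p0 * q2 + p1 * q1 + p2 * q0 = 0"
      "p1 * q2 + p2 * q1 = 0" "p2 * q2 = 1"
      using pq unfolding P Q by (simp_all add: algebra_simps)
    (* p2 * q2 = 1, so these are the coefficients of the monic multiples of p and q. *)
    define u v w where "u = p1 * q2" and "v = p0 * q2" and "w = q0 * p2"
    have vw: "v * w = - b"
      unfolding v_def w_def using e(1,5) by algebra
    have sum: "v + w = u ^ 2"
      using e(3-5) unfolding u_def v_def w_def by algebra
    have "u * (w - v) = 0"
      using e unfolding u_def v_def w_def by algebra
    then consider "u = 0" | "u \<noteq> 0" "w = v" by auto
    then show False
    proof cases
      case 1
      then have "v ^ 2 = b" using sum vw by algebra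
      then show False using nsq by blast
    next
      case 2
      have two: "(2::'a) \<noteq> 0"
      proof
        assume "(2::'a) = 0"
        then have "u ^ 2 = 0" using sum 2 by (simp flip: mult_2)
        then show False using 2 by simp
      qed
      define k where "k = u / 2"
      have "u = 2 * k" using two by (simp add: k_def)
      then have "2 * (v - 2 * k ^ 2) = 0" using sum 2 by algebra
      then have "v = 2 * k ^ 2" using two by (metis mult_eq_0_iff right_minus_eq)
      then have "- 4 * k ^ 4 = b" using vw 2 by algebra
      then show False using nq by blast
    qed
  qed
  ultimately have "degree p = 0 \<or> degree q = 0" using deg by linarith
  then show "is_unit p \<or> is_unit q" using nz by (auto simp: is_unit_iff_degree)
qed

text \<open>
  At \<open>T = t\<close> the factors are the two norms from \<open>K(\<beta>)\<close> to \<open>K\<close>, namely \<open>A(U)\<close> and \<open>A(-U)\<close> with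
  \<open>A(U) = U\<^sup>4 + 4 T U\<^sup>3 - 6 T\<^sup>2 U\<^sup>2 - 44 T\<^sup>3 U - 47 T\<^sup>4\<close>, evaluated at \<open>U = Y\<^sup>2\<close>.
\<close>
lemma second_iterate_factorization:
  fixes Y T :: "'a::comm_ring_1"
  shows "(Y ^ 4 - 7 * T ^ 2) ^ 4 - 192 * T ^ 8 =
    ((Y ^ 2) ^ 4 + 4 * T * (Y ^ 2) ^ 3 - 6 * T ^ 2 * (Y ^ 2) ^ 2 - 44 * T ^ 3 * Y ^ 2 - 47 * T ^ 4) *
    ((Y ^ 2) ^ 4 - 4 * T * (Y ^ 2) ^ 3 - 6 * T ^ 2 * (Y ^ 2) ^ 2 + 44 * T ^ 3 * Y ^ 2 - 47 * T ^ 4)"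
  by (simp add: algebra_simps eval_nat_numeral)

lemma pcompose_power:
  fixes p :: "'a::comm_semiring_1 poly"
  shows "pcompose (p ^ n) q = pcompose p q ^ n"
  by (induction n) (simp_all add: pcompose_mult pcompose_1)

lemma not_is_unit_pcompose_quartic_square:
  fixes h :: "'a::field"
  shows "\<not> is_unit (pcompose [:a0, a1, a2, a3, 1:] ([:h, 1:] ^ 2))"
proof -
  have "degree (pcompose [:a0, a1, a2, a3, 1:] ([:h, 1:] ^ 2)) = 8"
    by (simp add: degree_pcompose degree_power_eq)
  then show ?thesis by (auto simp: is_unit_poly_iff)
qed

theorem corollary6p3:
  fixes t :: "'a::field"
  assumes "CHAR('a) \<notin> {2, 3}"
    and "\<not> (\<exists>a::'a. a ^ 2 = 3)"
    and "\<not> (\<exists>a::'a. a ^ 4 = - 3)"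
    and "t \<noteq> 0"
  shows "newly_reducible_second_iterate
           ([:192 * t ^ 8 - 7 * t ^ 2, 1:] ^ 4 - [:192 * t ^ 8:])"
proof -
  define c where "c = 192 * t ^ 8 - 7 * t ^ 2"
  define Y where "Y = [:c, 1:]"
  define f where "f = Y ^ 4 - [:192 * t ^ 8:]"
  have two: "(2::'a) \<noteq> 0"
  proof
    assume "(2::'a) = 0"
    (* In characteristic 2 the element 3 = 1 would be a square. *)
    then have "(1::'a) + 2 = 1 ^ 2" by simp
    then have "(1::'a) ^ 2 = 3" by simp
    then show False using assms(2) by blast
  qed
  have "(8::'a) = 2 ^ 3" by simp
  then have nz: "2 * t ^ 2 \<noteq> 0" "8 * t ^ 4 \<noteq> 0"
    using two assms(4) by (metis mult_eq_0_iff power_not_zero)+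
  have "irreducible [:- (192 * t ^ 8), 0, 0, 0, 1:]"
  proof (rule irreducible_fourth_power_minus_const; rule notI; elim exE)
    fix a assume a: "a ^ 2 = 192 * t ^ 8"
    have "a ^ 2 = 3 * (8 * t ^ 4) ^ 2" using a by algebra
    then have "(a / (8 * t ^ 4)) ^ 2 = 3"
      using power_not_zero[OF nz(2)] by (metis power_divide nonzero_mult_div_cancel_right)
    then show False using assms(2) by blast
  next
    fix a assume a: "- 4 * a ^ 4 = 192 * t ^ 8"
    have "2 ^ 2 * (a ^ 4 + 3 * (2 * t ^ 2) ^ 4) = 0" using a by algebra
    then have "a ^ 4 + 3 * (2 * t ^ 2) ^ 4 = 0" using two by (metis mult_eq_0_iff power_not_zero)
    then have "a ^ 4 = - 3 * (2 * t ^ 2) ^ 4" by algebra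
    then have "(a / (2 * t ^ 2)) ^ 4 = - 3"
      using power_not_zero[OF nz(1)] by (metis power_divide nonzero_mult_div_cancel_right)
    then show False using assms(3) by blast
  qed
  from irreducible_pcompose_translation[OF this, of c] have irr: "irreducible f"
    by (simp add: f_def Y_def pcompose_pCons eval_nat_numeral algebra_simps)

  (* The norm polynomials A(U), A(-U) are composed with Y^2 rather than expanded in x,
     so that both degrees are read off from degree_pcompose. *)
  let ?A = "pcompose [:- 47 * t ^ 4, - 44 * t ^ 3, - 6 * t ^ 2, 4 * t, 1:] (Y ^ 2)"
  let ?B = "pcompose [:- 47 * t ^ 4, 44 * t ^ 3, - 6 * t ^ 2, - 4 * t, 1:] (Y ^ 2)"
  (* Passing from coefficients in K to the constant polynomial T turns the factorization
     into an identity between elements of the ring K[x]. *)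
  define T where "T = [:t:]"
  have T: "[:of_int n * t ^ k:] = of_int n * T ^ k" for n k
    by (simp add: T_def poly_const_pow of_int_poly)
  have "pcompose Y f = f + [:c:]" by (simp add: Y_def pcompose_pCons)
  also have "\<dots> = Y ^ 4 - 7 * T ^ 2"
  proof -
    have "[:c:] = [:192 * t ^ 8:] - [:7 * t ^ 2:]" by (simp add: c_def)
    moreover have "[:7 * t ^ 2:] = 7 * T ^ 2" using T[of 7 2] by simp
    ultimately show ?thesis unfolding f_def by algebra
  qed
  finally have Yf: "pcompose Y f = Y ^ 4 - 7 * T ^ 2" .
  have "pcompose f f = pcompose Y f ^ 4 - [:192 * t ^ 8:]"
    by (subst f_def) (simp add: pcompose_diff pcompose_power)
  also have "\<dots> = (Y ^ 4 - 7 * T ^ 2) ^ 4 - 192 * T ^ 8"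
    using T[of 192 8] unfolding Yf by simp
  also have "\<dots> = ?A * ?B"
  proof -
    have coeffs: "[:- 47 * t ^ 4:] = - 47 * T ^ 4" "[:- 44 * t ^ 3:] = - 44 * T ^ 3"
      "[:44 * t ^ 3:] = 44 * T ^ 3" "[:- 6 * t ^ 2:] = - 6 * T ^ 2"
      "[:4 * t:] = 4 * T" "[:- 4 * t:] = - 4 * T"
      using T[of "- 47" 4] T[of "- 44" 3] T[of 44 3] T[of "- 6" 2] T[of 4 1] T[of "- 4" 1]
      by (simp_all only: of_int_minus of_int_numeral of_int_neg_numeral power_one_right)
    show ?thesis
      unfolding second_iterate_factorization pcompose_pCons pcompose_0 coeffs one_pCons[symmetric] pcompose_1
      by algebra
  qed
  finally have "\<not> irreducible (pcompose f f)"
    using not_is_unit_pcompose_quartic_square irreducibleD unfolding Y_def by blast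
  with irr show ?thesis
    by (simp add: newly_reducible_second_iterate_def f_def Y_def c_def)
qed

end
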